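(* Let $G$ be a finite undirected graph with vertex set $V(G)=\{1,\dots,N\}$ and edge set $E(G)$, let $\varepsilon>0$, and for each edge $ij\in E(G)$ let $f_{ij}:\mathbb{R}\to\mathbb{R}$ be a $2\pi$-periodic, continuously differentiable, odd function with $f_{ij}=f_{ji}$. Let $\phi^*$ be an equilibrium of the system $$\dot\phi_i=\varepsilon\sum_{j\in\mathcal N_i} f_{ij}(\phi_j-\phi_i),\qquad i=1,\dots,N.$$ If there exists a cut $C(P)$ of $G$ such that $$\sum_{ij\in C(P)} f'_{ij}(\phi_j^*-\phi_i^* )<0,$$ then the equilibrium $\phi^*$ is unstable.
   Context: Phases $\phi_i$ take values in the unit circle $\mathbb{S}^1=\mathbb{R}/2\pi\mathbb{Z}$, so the state space is the $N$-torus $\mathcal T^N$. $\mathcal N_i$ denotes the set of neighbors of vertex $i$ in $G$. A partition $P=(V^-,V^+)$ of $V(G)$ satisfies $V^-\cup V^+=V(G)$ and $V^-\cap V^+=\emptyset$; its cut is $C(P)=\{ij\in E(G): i\in V^-, j\in V^+ \text{ or vice versa}\}$. Since each $f_{ij}$ is odd and $f_{ij}=f_{ji}$, the value $f'_{ij}(\phi_j^*-\phi_i^* )$ does not depend on the orientation of the edge $ij$. *)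

theory Defs
  imports "HOL-Analysis.Analysis"
begin

text \<open>
  The vertices are the elements of a finite type, and an edge \<open>ij\<close> is the unordered pair
  \<open>{i, j}\<close>.  Loops (\<open>i = j\<close>) are allowed; they contribute \<open>f i i 0 = 0\<close> to the vector field
  and never lie in a cut.
\<close>

definition undirected_graph :: "'n set set \<Rightarrow> bool" where
  "undirected_graph E \<longleftrightarrow> (\<forall>e\<in>E. \<exists>i j. e = {i, j})"

definition neighbors :: "'n set set \<Rightarrow> 'n \<Rightarrow> 'n set" where
  "neighbors E i = {j. {i, j} \<in> E}"

definition vertex_partition :: "'n set \<Rightarrow> 'n set \<Rightarrow> bool" where
  "vertex_partition A B \<longleftrightarrow> A \<union> B = UNIV \<and> A \<inter> B = {}"

definition cut :: "'n set set \<Rightarrow> 'n set \<Rightarrow> 'n set \<Rightarrow> 'n set set" where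
  "cut E A B = {e \<in> E. \<exists>i\<in>A. \<exists>j\<in>B. e = {i, j}}"

definition admissible_coupling :: "(real \<Rightarrow> real) \<Rightarrow> bool" where
  "admissible_coupling g \<longleftrightarrow>
     (\<forall>x. g (x + 2 * pi) = g x) \<and> g C1_differentiable_on UNIV \<and> (\<forall>x. g (- x) = - g x)"

definition coupling_field ::
  "'n set set \<Rightarrow> real \<Rightarrow> ('n \<Rightarrow> 'n \<Rightarrow> real \<Rightarrow> real) \<Rightarrow> real ^ 'n \<Rightarrow> real ^ 'n::finite" where
  "coupling_field E \<epsilon> f \<phi> = (\<chi> i. \<epsilon> * (\<Sum>j\<in>neighbors E i. f i j (\<phi> $ j - \<phi> $ i)))"

text \<open>
  The derivative of the coupling function of an edge at the phase difference along that edge.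
  The description operator expresses independence of the orientation of the edge; see
  \<open>edge_derivative_eq\<close>.
\<close>

definition edge_derivative ::
  "('n \<Rightarrow> 'n \<Rightarrow> real \<Rightarrow> real) \<Rightarrow> real ^ 'n \<Rightarrow> 'n::finite set \<Rightarrow> real" where
  "edge_derivative f \<phi> e = (THE s. \<exists>i j. e = {i, j} \<and> s = deriv (f i j) (\<phi> $ j - \<phi> $ i))"

lemma deriv_odd_even:
  assumes "admissible_coupling g"
  shows "deriv g (- x) = deriv g x"
proof -
  obtain D where D: "\<And>x. (g has_vector_derivative D x) (at x)"
    using assms unfolding admissible_coupling_def C1_differentiable_on_def by blast
  then have D': "\<And>x. (g has_real_derivative D x) (at x)"
    by (simp add: has_real_derivative_iff_has_vector_derivative)
  have "((\<lambda>y. - g (- y)) has_real_derivative D (- x)) (at x)"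
    by (rule derivative_eq_intros DERIV_chain'[OF _ D'] refl | simp)+
  moreover have "(\<lambda>y. - g (- y)) = g"
    using assms by (auto simp: admissible_coupling_def)
  ultimately show ?thesis
    using D' by (metis DERIV_imp_deriv)
qed

lemma edge_derivative_eq:
  assumes "admissible_coupling (f i j)" and "f i j = f j i"
  shows "edge_derivative f \<phi> {i, j} = deriv (f i j) (\<phi> $ j - \<phi> $ i)"
  unfolding edge_derivative_def
proof (rule the_equality)
  show "\<exists>i' j'. {i, j} = {i', j'} \<and>
      deriv (f i j) (\<phi> $ j - \<phi> $ i) = deriv (f i' j') (\<phi> $ j' - \<phi> $ i')"
    by blast
next
  fix s
  assume "\<exists>i' j'. {i, j} = {i', j'} \<and> s = deriv (f i' j') (\<phi> $ j' - \<phi> $ i')"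
  then show "s = deriv (f i j) (\<phi> $ j - \<phi> $ i)"
    using deriv_odd_even[OF assms(1), of "\<phi> $ j - \<phi> $ i"] assms(2)
    by (auto simp: doubleton_eq_iff)
qed

text \<open>
  A point of the torus \<open>(\<real> / 2\<pi>\<int>)\<^sup>N\<close> is represented by a vector of real angles, and a curve on
  the torus by a continuous lift.  Closeness is measured by the flat metric of the torus, so
  that stability below is stability on the torus.
\<close>

definition circle_dist :: "real \<Rightarrow> real \<Rightarrow> real" where
  "circle_dist x y = (INF k::int. \<bar>x - y + 2 * pi * of_int k\<bar>)"

definition torus_dist :: "real ^ 'n \<Rightarrow> real ^ 'n::finite \<Rightarrow> real" where
  "torus_dist x y = norm ((\<chi> i. circle_dist (x $ i) (y $ i)) :: real ^ 'n)"

definition forward_solution ::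
  "(real ^ 'n \<Rightarrow> real ^ 'n::finite) \<Rightarrow> (real \<Rightarrow> real ^ 'n) \<Rightarrow> bool" where
  "forward_solution F u \<longleftrightarrow>
     (\<forall>t\<ge>0. (u has_vector_derivative F (u t)) (at t within {0..}))"

definition equilibrium :: "(real ^ 'n \<Rightarrow> real ^ 'n::finite) \<Rightarrow> real ^ 'n \<Rightarrow> bool" where
  "equilibrium F p \<longleftrightarrow> F p = 0"

definition stable :: "(real ^ 'n \<Rightarrow> real ^ 'n::finite) \<Rightarrow> real ^ 'n \<Rightarrow> bool" where
  "stable F p \<longleftrightarrow>
     (\<forall>r>0. \<exists>d>0. \<forall>u. forward_solution F u \<longrightarrow> torus_dist (u 0) p < d \<longrightarrow>
        (\<forall>t\<ge>0. torus_dist (u t) p < r))"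

definition unstable :: "(real ^ 'n \<Rightarrow> real ^ 'n::finite) \<Rightarrow> real ^ 'n \<Rightarrow> bool" where
  "unstable F p \<longleftrightarrow> \<not> stable F p"

end

theory Submission imports Defs
begin

text \<open>
  The linearization \<open>J\<close> at the equilibrium is symmetric, and for the indicator vector \<open>v\<close> of one
  side of the cut \<open>v \<bullet> J v\<close> is \<open>- \<epsilon>\<close> times the cut sum, hence positive.  For a small \<open>c > 0\<close> that
  is not an eigenvalue of \<open>J\<close>, the quadratic form \<open>W x = x \<bullet> (J x - c x)\<close> is still positive at \<open>v\<close>,
  and its derivative along the flow is
  \<open>2 c W x + 2 \<bar>J x - c x\<bar>\<^sup>2 + o(\<bar>x\<bar>\<^sup>2) \<ge> 2 c W x\<close>
  near the equilibrium, because \<open>J - c\<close> is bounded below.  So \<open>W\<close> grows exponentially along the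
  solution starting at a small multiple of \<open>v\<close>, which therefore leaves a fixed neighbourhood.
  Periodicity makes the vector field globally Lipschitz, so that this solution exists for all time.
\<close>

section \<open>Solutions of Lipschitz differential equations\<close>

lemma integral_has_vector_derivative_ge:
  fixes h :: "real \<Rightarrow> 'a::banach"
  assumes "continuous_on {0..} h" "t \<ge> 0"
  shows "((\<lambda>t. integral {0..t} h) has_vector_derivative h t) (at t within {0..})"
proof -
  have "((\<lambda>t. integral {0..t} h) has_vector_derivative h t) (at t within {0..t+1})"
    using assms by (intro integral_has_vector_derivative) (auto intro: continuous_on_subset)
  moreover have "at t within {0..t+1} = at t within {0..}"
    by (rule at_within_nhd[of t "{..<t+1}"]) auto
  ultimately show ?thesis by simp
qed

text \<open>Integrating \<open>C * exp (K * s)\<close> gains a factor \<open>1 / K\<close>, and the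
  weight \<open>exp (- K * t)\<close> cancels the growth. Used twice below: to see that a Picard
  iterate is bounded, and to obtain the contraction factor.\<close>

lemma norm_integral_exp_bound:
  fixes h :: "real \<Rightarrow> 'a::banach"
  assumes "continuous_on {0..} h" "K > 0" "t \<ge> 0"
    and h: "\<And>s. s \<ge> 0 \<Longrightarrow> norm (h s) \<le> C * exp (K * s)"
  shows "norm (exp (- K * t) *\<^sub>R integral {0..t} h) \<le> C / K"
proof -
  have C: "C \<ge> 0" using order_trans[OF norm_ge_zero h[of 0]] by simp
  have i: "((\<lambda>s. C * exp (K * s)) has_integral C * exp (K * t) / K - C * exp (K * 0) / K) {0..t}"
    using assms(2,3)
    by (intro fundamental_theorem_of_calculus)
       (auto intro!: derivative_eq_intros simp flip: has_real_derivative_iff_has_vector_derivative)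
  have "norm (integral {0..t} h) \<le> integral {0..t} (\<lambda>s. C * exp (K * s))"
    using h assms(1) i
    by (intro integral_norm_bound_integral integrable_continuous_real)
       (auto intro: continuous_on_subset intro!: continuous_intros)
  also have "\<dots> = C * exp (K * t) / K - C / K"
    using integral_unique[OF i] by simp
  also have "\<dots> \<le> C * exp (K * t) / K"
    using C assms(2) by simp
  finally have "exp (- K * t) * norm (integral {0..t} h) \<le> exp (- K * t) * (C * exp (K * t) / K)"
    by (intro mult_left_mono) auto
  also have "\<dots> = C / K" by (simp add: exp_minus field_simps)
  finally show ?thesis by simp
qed

text \<open>Picard iteration for the rescaled curve \<open>exp (- K * t) *\<^sub>R u t\<close>
  (Bielecki's weighted norm). The contraction acts on the whole half-line at once, so local
  solutions never have to be glued.\<close>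

lemma lipschitz_forward_solution_exists:
  fixes F :: "real ^ 'n::finite \<Rightarrow> real ^ 'n"
  assumes lip: "L-lipschitz_on UNIV F"
  shows "\<exists>u. u 0 = x0 \<and> forward_solution F u"
proof -
  have L: "L \<ge> 0" using lip by (rule lipschitz_on_nonneg)
  \<comment> \<open>Any \<open>K > L\<close> gives contraction factor \<open>L / K < 1\<close>;
    adding 1 also keeps \<open>K\<close> positive when \<open>L = 0\<close>.\<close>
  define K where "K = L + 1"
  have K: "K > 0" using L by (simp add: K_def)
  have contF: "continuous_on UNIV F" using lip by (rule lipschitz_on_continuous_on)
  have lipF: "norm (F x - F y) \<le> L * norm (x - y)" for x y
    using lipschitz_onD[OF lip, of x y] by (simp add: dist_norm)
  define h where "h g s = F (exp (K * s) *\<^sub>R apply_bcontfun g s)"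
    for g :: "real \<Rightarrow>\<^sub>C (real ^ 'n)" and s
  have conth: "continuous_on S (h g)" for g S
    unfolding h_def
    by (intro continuous_on_compose2[OF contF] continuous_intros) auto
  define I where "I g t = integral {0..t} (h g)" for g t
  have dI: "(I g has_vector_derivative h g t) (at t within {0..})" if "t \<ge> 0" for g t
    unfolding I_def using integral_has_vector_derivative_ge[OF conth that] by simp
  have contI: "continuous_on {0..} (I g)" for g
    using dI by (intro continuous_on_vector_derivative) auto
  \<comment> \<open>Time is clamped to \<open>{0..}\<close> so that bounded continuous functions on the whole line can be used;
    the factor \<open>exp (- K t)\<close> makes the Picard operator a contraction for the supremum metric.\<close>
  define T0 where "T0 g t = exp (- K * max 0 t) *\<^sub>R (x0 + I g (max 0 t))" for g and t :: real
  \<comment> \<open>\<open>F\<close> grows at most linearly, so \<open>h g\<close> grows at most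
    like \<open>exp (K * s)\<close> for bounded \<open>g\<close>. Hence \<open>T0 g\<close> is
    bounded and \<open>Bcontfun\<close> returns a genuine representative of it.\<close>
  have bdd: "norm (T0 g t) \<le> norm x0 + (norm (F 0) + L * norm g) / K" for g t
  proof -
    have "norm (h g s) \<le> (norm (F 0) + L * norm g) * exp (K * s)" if "s \<ge> 0" for s
    proof -
      have "norm (h g s) \<le> norm (F 0) + norm (h g s - F 0)"
        by (metis add.commute diff_add_cancel norm_triangle_ineq)
      also have "\<dots> \<le> norm (F 0) + L * (exp (K * s) * norm (apply_bcontfun g s))"
        using lipF[of "exp (K * s) *\<^sub>R apply_bcontfun g s" 0] by (simp add: h_def)
      also have "\<dots> \<le> norm (F 0) * exp (K * s) + L * (exp (K * s) * norm g)"
        using L K that norm_bounded[of g s]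
        by (intro add_mono mult_left_mono) (auto simp: mult_le_cancel_left1)
      finally show ?thesis by (simp add: algebra_simps)
    qed
    then have "norm (exp (- K * max 0 t) *\<^sub>R I g (max 0 t)) \<le> (norm (F 0) + L * norm g) / K"
      unfolding I_def by (intro norm_integral_exp_bound[OF conth K]) auto
    moreover have "norm (exp (- K * max 0 t) *\<^sub>R x0) \<le> norm x0"
      using K by (auto intro!: mult_left_le_one_le)
    ultimately show ?thesis
      unfolding T0_def scaleR_add_right by (intro norm_triangle_le) linarith
  qed
  have cont: "continuous_on UNIV (T0 g)" for g
    unfolding T0_def
    by (intro continuous_intros continuous_on_compose2[OF contI]) auto
  define T where "T g = Bcontfun (T0 g)" for g
  have T: "apply_bcontfun (T g) = T0 g" for g
    unfolding T_def using bcontfun_normI[OF cont bdd] by (simp add: Bcontfun_inverse)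
  have "\<exists>!g. T g = g"
  proof (rule banach_fix_type[of "L / K"])
    show "0 \<le> L / K" "L / K < 1" using L by (auto simp: K_def)
    show "\<forall>g k. dist (T g) (T k) \<le> L / K * dist g k"
    proof (intro allI dist_bound)
      fix g k :: "real \<Rightarrow>\<^sub>C (real ^ 'n)" and t :: real
      have "norm (h g s - h k s) \<le> (L * dist g k) * exp (K * s)" for s
      proof -
        have "norm (h g s - h k s) \<le> L * norm (exp (K * s) *\<^sub>R (apply_bcontfun g s - apply_bcontfun k s))"
          unfolding h_def scaleR_diff_right by (rule lipF)
        also have "\<dots> = L * (exp (K * s) * dist (apply_bcontfun g s) (apply_bcontfun k s))"
          by (simp add: dist_norm)
        also have "\<dots> \<le> L * (exp (K * s) * dist g k)"
          using L by (intro mult_left_mono dist_bounded) auto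
        finally show ?thesis by (simp add: algebra_simps)
      qed
      then have "norm (exp (- K * max 0 t) *\<^sub>R integral {0..max 0 t} (\<lambda>s. h g s - h k s)) \<le> L * dist g k / K"
        using K conth by (intro norm_integral_exp_bound continuous_intros) auto
      moreover have "integral {0..max 0 t} (\<lambda>s. h g s - h k s) = I g (max 0 t) - I k (max 0 t)"
        unfolding I_def by (intro integral_diff integrable_continuous_real conth)
      ultimately show "dist (apply_bcontfun (T g) t) (apply_bcontfun (T k) t) \<le> L / K * dist g k"
        unfolding T T0_def dist_norm by (simp add: scaleR_diff_right scaleR_add_right)
    qed
  qed
  then obtain g where g: "T g = g" by blast
  \<comment> \<open>Undoing the rescaling turns the fixed point into a solution of the integral
    equation, on \<open>t \<ge> 0\<close> only because of the clamping.\<close>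
  define u where "u t = exp (K * t) *\<^sub>R apply_bcontfun g t" for t
  have u: "u t = x0 + I g t" if "t \<ge> 0" for t
  proof -
    have "apply_bcontfun g t = exp (- K * t) *\<^sub>R (x0 + I g t)"
      using fun_cong[OF T[of g], of t] g that by (simp add: T0_def)
    then show ?thesis by (simp add: u_def exp_minus)
  qed
  have hu: "h g t = F (u t)" for t by (simp add: h_def u_def)
  have "u 0 = x0" using u[of 0] by (simp add: I_def)
  moreover have "(u has_vector_derivative F (u t)) (at t within {0..})" if "t \<ge> 0" for t
  proof (rule has_vector_derivative_transform[where f = "\<lambda>t. x0 + I g t"])
    show "((\<lambda>t. x0 + I g t) has_vector_derivative F (u t)) (at t within {0..})"
      using dI[OF that, of g] by (auto intro!: derivative_eq_intros simp: hu)
  qed (use that u in auto)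
  ultimately show ?thesis unfolding forward_solution_def by blast
qed

section \<open>Instability from a self-adjoint linearization\<close>

text \<open>Eigenvectors for distinct eigenvalues of a self-adjoint map are orthogonal. One
  eigenvector per eigenvalue thus forms an independent set, which is finite in finite
  dimension.\<close>

lemma finite_eigenvalues_self_adjoint:
  fixes J :: "'a::euclidean_space \<Rightarrow> 'a"
  assumes sym: "\<And>x y. J x \<bullet> y = x \<bullet> J y"
  shows "finite {c. \<exists>x. x \<noteq> 0 \<and> J x = c *\<^sub>R x}"
proof -
  define C where "C = {c. \<exists>x. x \<noteq> 0 \<and> J x = c *\<^sub>R x}"
  then have "\<forall>c\<in>C. \<exists>x. x \<noteq> 0 \<and> J x = c *\<^sub>R x" by blast
  from bchoice[OF this] obtain e where e: "\<And>c. c \<in> C \<Longrightarrow> e c \<noteq> 0 \<and> J (e c) = c *\<^sub>R e c"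
    by blast
  have orth: "e c \<bullet> e d = 0" if "c \<in> C" "d \<in> C" "c \<noteq> d" for c d
    using sym[of "e c" "e d"] e that by simp
  have inj: "inj_on e C"
    using orth e by (intro inj_onI) (metis inner_eq_zero_iff)
  have "independent (e ` C)"
    using orth e by (intro pairwise_orthogonal_independent) (auto simp: pairwise_def orthogonal_def)
  then have "finite (e ` C)" by (simp add: independent_bound_general independent_imp_finite)
  then show ?thesis using inj C_def finite_imageD by blast
qed

text \<open>A Chetaev argument with the function \<open>W\<close>. The radius \<open>r\<close> is
  fixed before \<open>s\<close>, so starting points arbitrarily close to \<open>p\<close> all leave
  the same ball.\<close>

lemma forward_solution_leaves_ball:
  fixes F :: "real ^ 'n::finite \<Rightarrow> real ^ 'n"
  assumes F: "(F has_derivative J) (at p)" and p: "F p = 0"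
    and sym: "\<And>x y. J x \<bullet> y = x \<bullet> J y" and v: "v \<bullet> J v > 0"
  obtains r where "r > 0"
    "\<And>u s. forward_solution F u \<Longrightarrow> u 0 = p + s *\<^sub>R v \<Longrightarrow> s \<noteq> 0 \<Longrightarrow> \<exists>t\<ge>0. norm (u t - p) > r"
proof -
  have bl: "bounded_linear J" using F by (rule has_derivative_bounded_linear)
  have vv: "v \<bullet> v > 0" using v by auto
  \<comment> \<open>The upper end is the Rayleigh quotient of \<open>v\<close>: any \<open>c\<close>
    below it keeps the shifted form positive at \<open>v\<close>. Removing finitely many eigenvalues
    from the interval leaves a \<open>c\<close> for which \<open>J - c\<close> is injective.\<close>
  have "{0<..<v \<bullet> J v / (v \<bullet> v)} - {c. \<exists>x. x \<noteq> 0 \<and> J x = c *\<^sub>R x} \<noteq> {}"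
    using v vv finite_eigenvalues_self_adjoint[OF sym]
    by (intro infinite_imp_nonempty Diff_infinite_finite) auto
  then obtain c where c: "0 < c" "c < v \<bullet> J v / (v \<bullet> v)" "\<And>x. J x = c *\<^sub>R x \<Longrightarrow> x = 0"
    unfolding ex_in_conv[symmetric] Diff_iff mem_Collect_eq greaterThanLessThan_iff by metis
  define A where "A x = J x - c *\<^sub>R x" for x
  have blA: "bounded_linear A"
    unfolding A_def by (intro bounded_linear_sub bl bounded_linear_scaleR_right)
  have symA: "A x \<bullet> y = x \<bullet> A y" for x y
    by (simp add: A_def sym inner_diff_left inner_diff_right)
  have posA: "v \<bullet> A v > 0"
    using c(2) vv by (simp add: A_def inner_diff_right field_simps)
  have linA: "linear A" using blA by (rule bounded_linear.linear)
  have "inj A"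
    unfolding linear_injective_0[OF linA] using c(3) by (simp add: A_def)
  then obtain m where m: "m > 0" "\<And>x. m * norm x \<le> norm (A x)"
    using linear_inj_bounded_below_pos[OF linA] by blast
  obtain M where M: "\<And>x. norm (A x) \<le> norm x * M"
    using bounded_linear.bounded[OF blA] by blast
  \<comment> \<open>The lower bound \<open>m\<close> of \<open>A\<close> serves as the error
    constant in differentiability, so that the remainder of \<open>F\<close> is dominated by
    \<open>norm (A x)\<close>.\<close>
  obtain d where d: "d > 0"
    "\<And>y. norm (y - p) < d \<Longrightarrow> norm (F y - F p - J (y - p)) \<le> m * norm (y - p)"
    using F[unfolded has_derivative_at_alt] m(1) by blast
  define W where "W x = x \<bullet> A x" for x
  have W_bound: "W x \<le> \<bar>M\<bar> * d\<^sup>2" if "norm x < d" for x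
  proof -
    have "W x \<le> norm x * norm (A x)" unfolding W_def by (rule norm_cauchy_schwarz)
    also have "\<dots> \<le> norm x * (norm x * \<bar>M\<bar>)"
      using M[of x] by (intro mult_left_mono order_trans[OF M]) (auto intro: mult_left_mono)
    also have "\<dots> = \<bar>M\<bar> * (norm x)\<^sup>2" by (simp add: power2_eq_square)
    also have "\<dots> \<le> \<bar>M\<bar> * d\<^sup>2" using that by (intro mult_left_mono power_mono) auto
    finally show ?thesis .
  qed
  \<comment> \<open>Write \<open>F (p + x)\<close> as \<open>A x + R + c *\<^sub>R x\<close>. By
    Cauchy-Schwarz the square of \<open>norm (A x)\<close> absorbs \<open>A x \<bullet> R\<close>,
    which leaves \<open>c * W x\<close>.\<close>
  have W_growth: "2 * (A x \<bullet> F (p + x)) \<ge> 2 * c * W x" if "norm x < d" for x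
  proof -
    define R where "R = F (p + x) - J x"
    have R: "norm R \<le> norm (A x)"
      using d(2)[of "p + x"] that p m(2)[of x] by (simp add: R_def)
    have "- (A x \<bullet> R) \<le> norm (A x) * norm R"
      using norm_cauchy_schwarz[of "A x" "- R"] by simp
    also have "\<dots> \<le> norm (A x) * norm (A x)" using R by (intro mult_left_mono) auto
    also have "\<dots> = A x \<bullet> A x" by (simp add: dot_square_norm power2_eq_square)
    finally have "A x \<bullet> (A x + R) \<ge> 0" by (simp add: inner_add_right)
    moreover have "F (p + x) = (A x + R) + c *\<^sub>R x" by (simp add: R_def A_def)
    ultimately show ?thesis by (simp add: W_def inner_add_right inner_commute)
  qed
  \<comment> \<open>The radius is halved because denying escape gives only a non-strict bound, while
    the estimates need \<open>norm x < d\<close>.\<close>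
  have "\<exists>t\<ge>0. norm (u t - p) > d / 2"
    if u: "forward_solution F u" "u 0 = p + s *\<^sub>R v" "s \<noteq> 0" for u s
  proof (rule ccontr)
    assume "\<not> ?thesis"
    then have near: "norm (u t - p) < d" if "t \<ge> 0" for t using that d(1) by fastforce
    define w where "w t = W (u t - p)" for t
    \<comment> \<open>Integrating factor: by \<open>W_growth\<close>, \<open>G\<close> is
      nondecreasing, which says that \<open>w\<close> grows at least like
      \<open>exp (2 * c * t)\<close>.\<close>
    define G where "G t = exp (- 2 * c * t) * w t" for t
    have dw: "(w has_real_derivative 2 * (A (u t - p) \<bullet> F (u t))) (at t within {0..})"
      if "t \<ge> 0" for t
    proof -
      have 1: "((\<lambda>t. u t - p) has_vector_derivative F (u t)) (at t within {0..})"
        using u(1) that unfolding forward_solution_def by (auto intro!: derivative_eq_intros)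
      have "(w has_vector_derivative (u t - p) \<bullet> A (F (u t)) + F (u t) \<bullet> A (u t - p)) (at t within {0..})"
        unfolding w_def W_def
        by (intro bounded_bilinear.has_vector_derivative[OF bounded_bilinear_inner] 1
            bounded_linear.has_vector_derivative[OF blA])
      then show ?thesis
        using symA[of "u t - p" "F (u t)"]
        by (simp add: has_real_derivative_iff_has_vector_derivative inner_commute)
    qed
    have dG: "(G has_real_derivative
        exp (- 2 * c * t) * (2 * (A (u t - p) \<bullet> F (u t)) - 2 * c * w t)) (at t within {0..})"
      if "t \<ge> 0" for t
      unfolding G_def using dw[OF that]
      by (auto intro!: derivative_eq_intros simp: algebra_simps)
    have mono: "w 0 \<le> G t" if t: "t \<ge> 0" for t
    proof -
      have "G 0 \<le> G t"
      proof (rule DERIV_nonneg_imp_increasing_open[OF t])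
        fix x assume x: "0 < x" "x < t"
        then have "at x within {0..} = at x"
          by (intro at_within_interior) (auto simp: interior_real_atLeast)
        moreover have "2 * (A (u x - p) \<bullet> F (u x)) - 2 * c * w x \<ge> 0"
          using W_growth[of "u x - p"] near[of x] x by (simp add: w_def)
        ultimately show "\<exists>y. (G has_real_derivative y) (at x) \<and> 0 \<le> y"
          using dG[of x] x by (metis exp_ge_zero less_imp_le mult_nonneg_nonneg)
      next
        show "continuous_on {0..t} G"
          using dG by (intro continuous_on_subset[OF DERIV_continuous_on, of "{0..}" G]) auto
      qed
      then show ?thesis by (simp add: G_def)
    qed
    have "w 0 = s\<^sup>2 * (v \<bullet> A v)"
      by (simp add: w_def W_def u(2) linear_scale[OF linA] power2_eq_square)
    then have w0: "w 0 > 0" using posA u(3) by simp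
    have "exp (2 * c * t) * w 0 \<le> \<bar>M\<bar> * d\<^sup>2" if t: "t \<ge> 0" for t
    proof -
      have "exp (2 * c * t) * w 0 \<le> exp (2 * c * t) * G t"
        using mono[OF t] by simp
      also have "\<dots> = w t" by (simp add: G_def exp_minus)
      also have "\<dots> \<le> \<bar>M\<bar> * d\<^sup>2" unfolding w_def by (rule W_bound[OF near[OF t]])
      finally show ?thesis .
    qed
    then have bound: "(1 + 2 * c * t) * w 0 \<le> \<bar>M\<bar> * d\<^sup>2" if "t \<ge> 0" for t
      using that w0 exp_ge_add_one_self[of "2 * c * t"]
      by (meson mult_right_mono less_imp_le order_trans)
    \<comment> \<open>At this time \<open>2 * c * t * w 0\<close> already equals the bound, and the
      extra summand \<open>w 0 > 0\<close> exceeds it.\<close>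
    show False
      using bound[of "\<bar>M\<bar> * d\<^sup>2 / (2 * c * w 0)"] c(1) w0
      by (auto simp: field_simps dest: mult_pos_pos[OF w0])
  qed
  moreover have "d / 2 > 0" using d(1) by simp
  ultimately show thesis using that by blast
qed

section \<open>The flat metric of the torus\<close>

lemma circle_dist_le: "circle_dist x y \<le> \<bar>x - y\<bar>"
proof -
  have "bdd_below (range (\<lambda>k::int. \<bar>x - y + 2 * pi * of_int k\<bar>))"
    by (rule bdd_belowI2[of _ 0]) simp
  from cINF_lower[OF this UNIV_I[of 0]] show ?thesis by (simp add: circle_dist_def)
qed

lemma circle_dist_nonneg: "circle_dist x y \<ge> 0"
  unfolding circle_dist_def by (rule cINF_greatest) auto

text \<open>A nonzero multiple of \<open>2 * pi\<close> moves a difference of size at most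
  \<open>pi\<close> to one of size at least \<open>pi\<close>, so the infimum is attained at
  \<open>k = 0\<close>.\<close>

lemma circle_dist_eq:
  assumes "\<bar>x - y\<bar> \<le> pi"
  shows "circle_dist x y = \<bar>x - y\<bar>"
proof (rule antisym[OF circle_dist_le])
  have "\<bar>x - y\<bar> \<le> \<bar>x - y + 2 * pi * of_int k\<bar>" for k :: int
  proof (cases "k = 0")
    case False
    then have "\<bar>real_of_int k\<bar> \<ge> 1" by linarith
    then have "\<bar>2 * pi * real_of_int k\<bar> \<ge> 2 * pi" by (simp add: abs_mult)
    then show ?thesis using assms by linarith
  qed simp
  then show "\<bar>x - y\<bar> \<le> circle_dist x y"
    unfolding circle_dist_def by (intro cINF_greatest) auto
qed

lemma torus_dist_le: "torus_dist x y \<le> norm (x - y)"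
  unfolding torus_dist_def
  by (rule norm_le_componentwise_cart) (simp add: circle_dist_nonneg circle_dist_le)

lemma circle_dist_le_torus_dist: "circle_dist (x $ i) (y $ i) \<le> torus_dist x y"
  using component_le_norm_cart[of "(\<chi> i. circle_dist (x $ i) (y $ i))" i]
  by (simp add: torus_dist_def circle_dist_nonneg)

text \<open>A lifted curve that stays close to \<open>p\<close> on the torus cannot jump to another lift of \<open>p\<close>.\<close>

lemma lift_stays_close:
  fixes u :: "real \<Rightarrow> real ^ 'n::finite"
  assumes cont: "continuous_on {0..} u" and r: "r \<le> pi"
    and tor: "\<And>t. t \<ge> 0 \<Longrightarrow> torus_dist (u t) p < r"
    and u0: "norm (u 0 - p) < r" and t: "t \<ge> 0"
  shows "\<bar>u t $ i - p $ i\<bar> < r"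
proof (rule ccontr)
  assume "\<not> ?thesis"
  moreover have "\<bar>u 0 $ i - p $ i\<bar> \<le> r"
    using component_le_norm_cart[of "u 0 - p" i] u0 by simp
  moreover have "continuous_on {0..t} (\<lambda>t. \<bar>u t $ i - p $ i\<bar>)"
    by (intro continuous_intros continuous_on_subset[OF cont]) auto
  \<comment> \<open>Leaving the interval forces the value exactly \<open>r\<close> by the
    intermediate value theorem; as \<open>r \<le> pi\<close>, the circle distance there is also
    \<open>r\<close>.\<close>
  ultimately obtain s where s: "s \<ge> 0" "\<bar>u s $ i - p $ i\<bar> = r"
    using IVT'[of "\<lambda>t. \<bar>u t $ i - p $ i\<bar>" 0 r t] t by auto
  then have "circle_dist (u s $ i) (p $ i) = r" using circle_dist_eq r by simp
  then show False using circle_dist_le_torus_dist[of "u s" i p] tor[OF s(1)] by simp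
qed

text \<open>Escape of lifts from a Euclidean ball becomes instability on the torus: a lift that
  stays close on the torus would also stay close in every coordinate.\<close>

lemma unstable_if_self_adjoint_linearization:
  fixes F :: "real ^ 'n::finite \<Rightarrow> real ^ 'n"
  assumes lip: "L-lipschitz_on UNIV F"
    and "(F has_derivative J) (at p)" "F p = 0" "\<And>x y. J x \<bullet> y = x \<bullet> J y" "v \<bullet> J v > 0"
  shows "unstable F p"
  unfolding unstable_def
proof
  assume st: "stable F p"
  obtain r where r: "r > 0"
    "\<And>u s. forward_solution F u \<Longrightarrow> u 0 = p + s *\<^sub>R v \<Longrightarrow> s \<noteq> 0 \<Longrightarrow> \<exists>t\<ge>0. norm (u t - p) > r"
    using forward_solution_leaves_ball[OF assms(2-5)] by blast
  \<comment> \<open>The cap \<open>pi\<close> is what \<open>lift_stays_close\<close> requires;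
    division by the dimension lets the sum of the coordinate bounds stay within
    \<open>r\<close>.\<close>
  define q where "q = min pi (r / CARD('n))"
  have q: "q > 0" "q \<le> pi" "CARD('n) * q \<le> r"
    using r(1) by (auto simp: q_def min_def field_simps)
  obtain d where d: "d > 0" "\<And>u t. forward_solution F u \<Longrightarrow> torus_dist (u 0) p < d \<Longrightarrow> t \<ge> 0 \<Longrightarrow>
      torus_dist (u t) p < q"
    using st q(1) unfolding stable_def by metis
  \<comment> \<open>The start lies within \<open>d\<close>, for the stability assumption, and within
    \<open>q\<close>, so that the lift begins near \<open>p\<close> itself and not near another lift
    of it.\<close>
  define s where "s = min d q / (2 * norm v)"
  have v: "norm v > 0" using assms(5) by auto
  have s: "s > 0" "s * norm v < d" "s * norm v < q"
    using d(1) q(1) v by (auto simp: s_def)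
  obtain u where u: "u 0 = p + s *\<^sub>R v" "forward_solution F u"
    using lipschitz_forward_solution_exists[OF lip] by blast
  have u0: "norm (u 0 - p) = s * norm v" using s(1) u(1) by simp
  have tor: "torus_dist (u t) p < q" if "t \<ge> 0" for t
    using d(2)[OF u(2) _ that] torus_dist_le[of "u 0" p] u0 s(2) by simp
  have cont: "continuous_on {0..} u"
    using u(2) unfolding forward_solution_def by (intro continuous_on_vector_derivative) auto
  obtain t where t: "t \<ge> 0" "norm (u t - p) > r" using r(2)[OF u(2,1)] s(1) by auto
  have "norm (u t - p) \<le> (\<Sum>i\<in>UNIV. \<bar>(u t - p) $ i\<bar>)" by (rule norm_le_l1_cart)
  also have "\<dots> \<le> (\<Sum>i\<in>(UNIV::'n set). q)"
    using lift_stays_close[OF cont q(2) tor _ t(1)] u0 s(3) by (intro sum_mono) (auto simp: less_imp_le)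
  finally show False using q(3) t(2) by simp
qed

section \<open>The coupling field\<close>

lemma admissible_coupling_has_deriv:
  assumes "admissible_coupling g"
  shows "(g has_real_derivative deriv g x) (at x)"
proof -
  obtain D where "(g has_vector_derivative D x) (at x)"
    using assms unfolding admissible_coupling_def C1_differentiable_on_def by blast
  then have "(g has_real_derivative D x) (at x)"
    by (simp add: has_real_derivative_iff_has_vector_derivative)
  then show ?thesis using DERIV_imp_deriv by metis
qed

text \<open>The derivative is continuous and inherits the period, so its bound on one period is
  global; the mean value inequality does the rest.\<close>

lemma admissible_coupling_lipschitz:
  assumes g: "admissible_coupling g"
  obtains L where "L-lipschitz_on UNIV g"
proof -
  have per: "g (x + 2 * pi) = g x" for x using g by (auto simp: admissible_coupling_def)
  have der: "(g has_real_derivative deriv g x) (at x)" for x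
    by (rule admissible_coupling_has_deriv[OF g])
  have "deriv g (x + 2 * pi) = deriv g x" for x
  proof -
    have "((\<lambda>x. g (x + 2 * pi)) has_real_derivative deriv g (x + 2 * pi)) (at x)"
      by (subst DERIV_shift[symmetric]) (rule der)
    then show ?thesis using per by (simp add: DERIV_imp_deriv)
  qed
  then interpret periodic_fun_simple "deriv g" "2 * pi" by unfold_locales
  obtain D where D: "continuous_on UNIV D" "\<And>x. (g has_vector_derivative D x) (at x)"
    using g unfolding admissible_coupling_def C1_differentiable_on_def by blast
  have "deriv g = D"
    using D(2) by (auto simp: DERIV_imp_deriv simp flip: has_real_derivative_iff_has_vector_derivative)
  then have "compact (deriv g ` {0..2 * pi})"
    using D(1) by (intro compact_continuous_image) (auto intro: continuous_on_subset)
  then obtain B where B: "\<And>x. x \<in> {0..2 * pi} \<Longrightarrow> norm (deriv g x) \<le> B"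
    using compact_imp_bounded bounded_iff by (metis imageI)
  have "norm (deriv g x) \<le> B" for x
  proof -
    define k where "k = \<lfloor>x / (2 * pi)\<rfloor>"
    have "of_int k \<le> x / (2 * pi)" "x / (2 * pi) < of_int k + 1"
      unfolding k_def by linarith+
    then have "x - of_int k * (2 * pi) \<in> {0..2 * pi}" by (simp add: field_simps)
    then show ?thesis using B[of "x - of_int k * (2 * pi)"] minus_of_int[of x k] by simp
  qed
  then have "norm (g x - g y) \<le> B * norm (x - y)" for x y
    using field_differentiable_bound[of UNIV g "deriv g" B] der by auto
  moreover have "B \<ge> 0" using B[of 0] norm_ge_zero[of "deriv g 0"] by (auto intro: order_trans)
  ultimately have "B-lipschitz_on UNIV g" by (intro lipschitz_onI) (auto simp: dist_norm)
  then show thesis by (rule that)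
qed

lemma coupling_field_lipschitz:
  fixes f :: "'n::finite \<Rightarrow> 'n \<Rightarrow> real \<Rightarrow> real"
  assumes f: "\<And>i j. {i, j} \<in> E \<Longrightarrow> admissible_coupling (f i j)"
  obtains L where "L-lipschitz_on UNIV (coupling_field E \<epsilon> f)"
proof -
  \<comment> \<open>Couplings are controlled on edges only; placing the implication under the
    quantifier permits choosing one total function \<open>L\<close>.\<close>
  have "\<exists>L. {i, j} \<in> E \<longrightarrow> L-lipschitz_on UNIV (f i j)" for i j
    using admissible_coupling_lipschitz[OF f] by metis
  then obtain L where L: "\<And>i j. {i, j} \<in> E \<Longrightarrow> (L i j)-lipschitz_on UNIV (f i j)" by metis
  let ?F = "coupling_field E \<epsilon> f"
  \<comment> \<open>The factor 2 arises because a phase difference involves two coordinates; the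
    outer sum comes from bounding the norm by the sum of the absolute coordinates.\<close>
  define C where "C = (\<Sum>i\<in>UNIV. \<bar>\<epsilon>\<bar> * (\<Sum>j\<in>neighbors E i. L i j * 2))"
  have L0: "L i j \<ge> 0" if "j \<in> neighbors E i" for i j
    using L[of i j] that lipschitz_on_nonneg by (auto simp: neighbors_def)
  have "norm (?F x - ?F y) \<le> C * norm (x - y)" for x y
  proof -
    have 1: "\<bar>f i j (x $ j - x $ i) - f i j (y $ j - y $ i)\<bar> \<le> L i j * 2 * norm (x - y)"
      if "j \<in> neighbors E i" for i j
    proof -
      have "\<bar>f i j (x $ j - x $ i) - f i j (y $ j - y $ i)\<bar> \<le> L i j * \<bar>(x $ j - x $ i) - (y $ j - y $ i)\<bar>"
        using lipschitz_onD[OF L[of i j], of "x $ j - x $ i" "y $ j - y $ i"] that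
        by (simp add: neighbors_def dist_real_def)
      also have "\<dots> \<le> L i j * (2 * norm (x - y))"
        using component_le_norm_cart[of "x - y" i] component_le_norm_cart[of "x - y" j]
        by (intro mult_left_mono L0 that) simp
      finally show ?thesis by simp
    qed
    have "norm (?F x - ?F y) \<le> (\<Sum>i\<in>UNIV. \<bar>(?F x - ?F y) $ i\<bar>)" by (rule norm_le_l1_cart)
    also have "\<dots> \<le> (\<Sum>i\<in>UNIV. \<bar>\<epsilon>\<bar> * (\<Sum>j\<in>neighbors E i. L i j * 2) * norm (x - y))"
    proof (rule sum_mono)
      fix i
      have "\<bar>(?F x - ?F y) $ i\<bar> =
          \<bar>\<epsilon>\<bar> * \<bar>\<Sum>j\<in>neighbors E i. f i j (x $ j - x $ i) - f i j (y $ j - y $ i)\<bar>"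
        by (simp add: coupling_field_def sum_subtractf abs_mult flip: right_diff_distrib)
      also have "\<dots> \<le> \<bar>\<epsilon>\<bar> * (\<Sum>j\<in>neighbors E i. L i j * 2 * norm (x - y))"
        using 1 by (intro mult_left_mono order_trans[OF sum_abs] sum_mono) auto
      finally show "\<bar>(?F x - ?F y) $ i\<bar> \<le> \<bar>\<epsilon>\<bar> * (\<Sum>j\<in>neighbors E i. L i j * 2) * norm (x - y)"
        by (simp add: sum_distrib_right mult.assoc)
    qed
    finally show ?thesis by (simp add: C_def sum_distrib_right)
  qed
  moreover have "C \<ge> 0"
    unfolding C_def using L0 by (intro sum_nonneg mult_nonneg_nonneg) auto
  ultimately show thesis using that[of C] by (auto simp: lipschitz_on_def dist_norm)
qed

text \<open>This is \<open>- \<epsilon>\<close> times the Laplacian of the graph with edge weights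
  \<open>a\<close>, which may be negative.\<close>

definition coupling_jacobian ::
  "'n set set \<Rightarrow> real \<Rightarrow> ('n \<Rightarrow> 'n \<Rightarrow> real) \<Rightarrow> real ^ 'n \<Rightarrow> real ^ 'n::finite" where
  "coupling_jacobian E \<epsilon> a v = (\<chi> i. \<epsilon> * (\<Sum>j\<in>neighbors E i. a i j * (v $ j - v $ i)))"

lemma has_derivative_coupling_field:
  fixes f :: "'n::finite \<Rightarrow> 'n \<Rightarrow> real \<Rightarrow> real"
  assumes f: "\<And>i j. {i, j} \<in> E \<Longrightarrow> admissible_coupling (f i j)"
  shows "(coupling_field E \<epsilon> f has_derivative
    coupling_jacobian E \<epsilon> (\<lambda>i j. deriv (f i j) (\<phi> $ j - \<phi> $ i))) (at \<phi>)"
proof -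
  have 1: "((\<lambda>x. f i j (x $ j - x $ i)) has_derivative
      (\<lambda>v. deriv (f i j) (\<phi> $ j - \<phi> $ i) * (v $ j - v $ i))) (at \<phi>)"
    if "j \<in> neighbors E i" for i j
  proof -
    have "(f i j has_derivative (*) (deriv (f i j) (\<phi> $ j - \<phi> $ i))) (at (\<phi> $ j - \<phi> $ i))"
      using admissible_coupling_has_deriv[OF f] that
      by (simp add: neighbors_def has_field_derivative_def)
    moreover have "((\<lambda>x. x $ j - x $ i) has_derivative (\<lambda>v. v $ j - v $ i)) (at \<phi>)"
      by (intro has_derivative_diff bounded_linear_imp_has_derivative bounded_linear_vec_nth)
    ultimately show ?thesis by (rule has_derivative_compose[rotated])
  qed
  have "((\<lambda>x. coupling_field E \<epsilon> f x \<bullet> b) has_derivative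
      (\<lambda>v. coupling_jacobian E \<epsilon> (\<lambda>i j. deriv (f i j) (\<phi> $ j - \<phi> $ i)) v \<bullet> b)) (at \<phi>)"
    if b: "b \<in> Basis" for b :: "real ^ 'n"
  proof -
    obtain i where "b = axis i 1" using b unfolding Basis_vec_def by auto
    then show ?thesis
      by (auto simp: inner_axis coupling_field_def coupling_jacobian_def
          intro!: has_derivative_mult_right has_derivative_sum 1)
  qed
  then show ?thesis using has_derivative_componentwise_within[of _ _ \<phi> UNIV] by blast
qed

text \<open>Extending the neighbor sums to all vertices makes the index ranges independent, so that
  the two sums can be exchanged.\<close>

lemma coupling_jacobian_inner:
  "coupling_jacobian E \<epsilon> a v \<bullet> w =
    \<epsilon> * (\<Sum>i\<in>UNIV. \<Sum>j\<in>UNIV. if {i, j} \<in> E then a i j * (v $ j - v $ i) * w $ i else 0)"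
proof -
  have "(\<Sum>j\<in>neighbors E i. a i j * (v $ j - v $ i)) * w $ i =
      (\<Sum>j\<in>UNIV. if {i, j} \<in> E then a i j * (v $ j - v $ i) * w $ i else 0)" for i
    unfolding neighbors_def sum_distrib_right
    by (rule sum.mono_neutral_cong_left) auto
  then show ?thesis
    by (simp add: coupling_jacobian_def inner_vec_def mult.assoc flip: sum_distrib_left)
qed

text \<open>After splitting off the diagonal part, which is symmetric term by term, exchanging the
  two sums and \<open>a i j = a j i\<close> settle the rest.\<close>

lemma coupling_jacobian_self_adjoint:
  assumes "\<And>i j. {i, j} \<in> E \<Longrightarrow> a i j = a j i"
  shows "coupling_jacobian E \<epsilon> a v \<bullet> w = v \<bullet> coupling_jacobian E \<epsilon> a w"
proof -
  define S where "S = (\<lambda>v w :: real ^ 'a.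
    \<Sum>i\<in>UNIV. \<Sum>j\<in>UNIV. if {i, j} \<in> E then a i j * (v $ j - v $ i) * w $ i else 0)"
  have swap: "(\<Sum>i\<in>UNIV. \<Sum>j\<in>UNIV. if {i, j} \<in> E then a i j * v $ j * w $ i else 0) =
      (\<Sum>i\<in>UNIV. \<Sum>j\<in>UNIV. if {i, j} \<in> E then a i j * w $ j * v $ i else 0)"
    by (subst sum.swap) (auto intro!: sum.cong simp: assms insert_commute)
  have split: "S v w = (\<Sum>i\<in>UNIV. \<Sum>j\<in>UNIV. if {i, j} \<in> E then a i j * v $ j * w $ i else 0)
      - (\<Sum>i\<in>UNIV. \<Sum>j\<in>UNIV. if {i, j} \<in> E then a i j * v $ i * w $ i else 0)" for v w
    unfolding S_def
    by (auto simp: algebra_simps simp flip: sum_subtractf intro!: sum.cong)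
  have "S v w = S w v"
    unfolding split swap by (simp add: mult_ac cong: if_cong)
  then show ?thesis
    by (simp add: coupling_jacobian_inner inner_commute[of v] S_def)
qed

text \<open>A term survives only for \<open>i\<close> in \<open>A\<close> and \<open>j\<close>
  outside \<open>A\<close>, where it equals \<open>- a i j\<close>; so each cut edge is counted
  once.\<close>

lemma coupling_jacobian_indicator:
  fixes A B :: "'n::finite set"
  assumes part: "vertex_partition A B"
    and a: "\<And>i j. {i, j} \<in> E \<Longrightarrow> a i j = b {i, j}"
  shows "(\<chi> i. indicator A i) \<bullet> coupling_jacobian E \<epsilon> a (\<chi> i. indicator A i) =
    - \<epsilon> * (\<Sum>e\<in>cut E A B. b e)"
proof -
  \<comment> \<open>Each cut edge is oriented from \<open>A\<close> to \<open>B\<close>;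
    disjointness of the sides makes the orientation unique, hence the map to unordered pairs
    injective.\<close>
  define P where "P = {(i, j). i \<in> A \<and> j \<in> B \<and> {i, j} \<in> E}"
  have AB: "x \<in> B \<longleftrightarrow> x \<notin> A" for x using part by (auto simp: vertex_partition_def)
  have inj: "inj_on (\<lambda>(i, j). {i, j}) P"
    by (auto simp: inj_on_def P_def doubleton_eq_iff AB)
  have "cut E A B = (\<lambda>(i, j). {i, j}) ` P"
    by (auto simp: cut_def P_def)
  then have "(\<Sum>e\<in>cut E A B. b e) = (\<Sum>(i, j)\<in>P. a i j)"
    using a by (simp add: sum.reindex[OF inj]) (auto simp: P_def intro!: sum.cong)
  also have "\<dots> = (\<Sum>(i, j)\<in>UNIV. if (i, j) \<in> P then a i j else 0)"
    by (rule sum.mono_neutral_cong_left) auto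
  also have "\<dots> = (\<Sum>i\<in>UNIV. \<Sum>j\<in>UNIV. if (i, j) \<in> P then a i j else 0)"
    by (simp add: sum.cartesian_product)
  also have "\<dots> = - (\<Sum>i\<in>UNIV. \<Sum>j\<in>UNIV. if {i, j} \<in> E
      then a i j * (indicator A j - indicator A i) * indicator A i else 0)"
    by (auto simp: P_def AB indicator_def simp flip: sum_negf intro!: sum.cong)
  finally show ?thesis
    by (simp add: coupling_jacobian_inner inner_commute[of "\<chi> i. indicator A i"] cong: if_cong)
qed

theorem mainTheorem1:
  fixes E :: "'n::finite set set"
    and \<epsilon> :: real
    and f :: "'n \<Rightarrow> 'n \<Rightarrow> real \<Rightarrow> real"
    and \<phi> :: "real ^ 'n"
  assumes "undirected_graph E"
    and "\<epsilon> > 0"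
    and "\<And>i j. {i, j} \<in> E \<Longrightarrow> admissible_coupling (f i j)"
    and "\<And>i j. {i, j} \<in> E \<Longrightarrow> f i j = f j i"
    and "equilibrium (coupling_field E \<epsilon> f) \<phi>"
    and "\<exists>A B. vertex_partition A B \<and> (\<Sum>e\<in>cut E A B. edge_derivative f \<phi> e) < 0"
  shows "unstable (coupling_field E \<epsilon> f) \<phi>"
proof -
  define a where "a i j = deriv (f i j) (\<phi> $ j - \<phi> $ i)" for i j
  obtain A B where AB: "vertex_partition A B" "(\<Sum>e\<in>cut E A B. edge_derivative f \<phi> e) < 0"
    using assms(6) by blast
  have a: "a i j = edge_derivative f \<phi> {i, j}" if "{i, j} \<in> E" for i j
    unfolding a_def using edge_derivative_eq[of f i j, OF assms(3)[OF that] assms(4)[OF that]] by simp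
  \<comment> \<open>Symmetry is inherited from \<open>{i, j} = {j, i}\<close>, as
    \<open>edge_derivative\<close> depends on the unordered edge alone.\<close>
  have a_sym: "a i j = a j i" if "{i, j} \<in> E" for i j
    using a that by (simp add: insert_commute)
  obtain L where L: "L-lipschitz_on UNIV (coupling_field E \<epsilon> f)"
    by (rule coupling_field_lipschitz[OF assms(3)])
  show ?thesis
  proof (rule unstable_if_self_adjoint_linearization[OF L])
    show "(coupling_field E \<epsilon> f has_derivative coupling_jacobian E \<epsilon> a) (at \<phi>)"
      unfolding a_def by (rule has_derivative_coupling_field[OF assms(3)])
    show "coupling_field E \<epsilon> f \<phi> = 0" using assms(5) by (simp add: equilibrium_def)
    show "coupling_jacobian E \<epsilon> a x \<bullet> y = x \<bullet> coupling_jacobian E \<epsilon> a y" for x y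
      by (rule coupling_jacobian_self_adjoint[OF a_sym])
    show "(\<chi> i. indicator A i) \<bullet> coupling_jacobian E \<epsilon> a (\<chi> i. indicator A i) > 0"
      using coupling_jacobian_indicator[where a = a and E = E and b = "edge_derivative f \<phi>" and \<epsilon> = \<epsilon>,
          OF AB(1) a] AB(2) assms(2)
      by (simp add: mult_pos_neg)
  qed
qed

end
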